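(* Let $S\subset\mathbb{R}^n$ be closed and convex, let $\phi:\mathbb{R}^n\times\mathbb{R}^n\to\mathbb{R}$ satisfy $\phi(x,x)=0$ for all $x\in S$, and let $\bar S=\{x\in S\mid \phi(x,y)\ge 0\ \forall y\in S\}$ be nonempty and closed. Suppose $\partial_y\phi(x,x)\neq\emptyset$ for every $x\in S$, let $\{x^k\}\subset S$ be a sequence, and suppose $\bar S$ is augmented weakly sharp with respect to $\{x^k\}$. Then: (i) Suppose that $\bar S\subseteq\tilde S$, where $\tilde S=\{x\in S\mid \exists u\in\partial_y\phi(x,x)\text{ such that }\langle u,y-x\rangle\ge 0\ \forall y\in S\}$. If $\{x^k\}$ terminates finitely to $\bar S$, then $$0\in\liminf_{k\to\infty}P_{T_S(x^k)}\bigl(-\partial_y\phi(x^k,x^k)\bigr).$$ (ii) If $0\in\liminf_{k\to\infty}P_{T_S(x^k)}(-\partial_y\phi(x^k,x^k))$, then $\{x^k\}$ terminates finitely to $\bar S$.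
   Context: For $x\in S$, $\partial_y\phi(x,x)$ is the (general/limiting) subdifferential at the point $x$ of the function $\phi(x,\cdot)$. Here $v\in\partial g(x)$ iff there are $x^j\to x$ with $g(x^j)\to g(x)$ and $v^j\to v$ with $g(y)\ge g(x^j)+\langle v^j,y-x^j\rangle+o(\|y-x^j\|)$ for each $j$ (regular subgradients). For $C\subset\mathbb{R}^n$ and $x\in C$: the tangent cone $T_C(x)$ is the set of $d$ for which there are $x^j\in C$, $x^j\to x$, $\tau^j\downarrow0$ with $(x^j-x)/\tau^j\to d$; the regular normal cone is $\hat N_C(x)=\{d\mid\langle d,y-x\rangle\le o(\|y-x\|),\ y\in C\}$. For a set $D$, the polar cone is $D^\circ=\{y\mid\langle y,d\rangle\le0\ \forall d\in D\}$. $B$ is the closed unit ball. $P_C(x)$ is the projection, i.e. a point of $\arg\min_{y\in C}\|y-x\|$; if $C$ is closed but not convex and the nearest point is not unique, $P_C(x)$ denotes one nearest point, chosen once and for all. For a set $U$, $P_{T_S(x)}(-U)=\{P_{T_S(x)}(-u)\mid u\in U\}$. For sets $C^k\subset\mathbb{R}^n$, $\liminf_{k\to\infty}C^k=\{x\mid\exists x^k\in C^k\text{ with }x^k\to x\}$. A sequence $\{x^k\}$ terminates finitely to $C$ if there is $k_0$ with $x^k\in C$ for all $k\ge k_0$. Augmented weak sharpness: Let $\bar S$ be closed, $\partial_y\phi(x,x)\ne\emptyset$ for all $x\in S$, and $\{x^k\}\subset S$. $\bar S$ is augmented weakly sharp with respect to $\{x^k\}$ if, whenever $K=\{k\mid x^k\notin\bar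 S\}$ is infinite, there exists a set-valued mapping $H:\bar S\to2^{\mathbb{R}^n}$ such that (a) there is a constant $\alpha>0$ with $\alpha B\subset H(z)+[T_S(z)\cap\hat N_{\bar S}(z)]^\circ$ for all $z\in\bar S$; (b) for all choices $u^k\in\partial_y\phi(x^k,x^k)$ and $v^k\in H(P_{\bar S}(x^k))$ ($k\in K$), $$\limsup_{k\in K,\,k\to\infty}\frac{1}{\|x^k-P_{\bar S}(x^k)\|}\langle u^k-v^k,\,x^k-P_{\bar S}(x^k)\rangle\ge0.$$ (If $K$ is finite the condition holds vacuously.) *)

theory Defs
  imports "HOL-Analysis.Analysis" "HOL-Library.Landau_Symbols" "HOL-Library.Set_Algebras"
begin

definition regular_subgradients ::
    "('a::euclidean_space \<Rightarrow> real) \<Rightarrow> 'a \<Rightarrow> 'a set" where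
  "regular_subgradients g x =
     {v. \<exists>r \<in> o[at x](\<lambda>y. norm (y - x)). \<forall>y. g y \<ge> g x + v \<bullet> (y - x) + r y}"

definition limiting_subdifferential ::
    "('a::euclidean_space \<Rightarrow> real) \<Rightarrow> 'a \<Rightarrow> 'a set" where
  "limiting_subdifferential g x =
     {v. \<exists>xs vs. xs \<longlonglongrightarrow> x \<and> (\<lambda>j. g (xs j)) \<longlonglongrightarrow> g x \<and> vs \<longlonglongrightarrow> v \<and>
        (\<forall>j::nat. vs j \<in> regular_subgradients g (xs j))}"

text \<open>The set \<open>\<partial>\<^sub>y\<phi>(x,x)\<close>: the first argument is frozen at \<open>x\<close>.\<close>

definition diag_subdifferential ::
    "('a::euclidean_space \<Rightarrow> 'a \<Rightarrow> real) \<Rightarrow> 'a \<Rightarrow> 'a set" where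
  "diag_subdifferential \<phi> x = limiting_subdifferential (\<phi> x) x"

definition tangent_cone :: "'a::euclidean_space set \<Rightarrow> 'a \<Rightarrow> 'a set" where
  "tangent_cone C x =
     {d. \<exists>xs \<tau>. (\<forall>j::nat. xs j \<in> C) \<and> xs \<longlonglongrightarrow> x \<and> (\<forall>j. \<tau> j > 0) \<and> \<tau> \<longlonglongrightarrow> 0 \<and>
        (\<lambda>j. (xs j - x) /\<^sub>R \<tau> j) \<longlonglongrightarrow> d}"

definition regular_normal_cone :: "'a::euclidean_space set \<Rightarrow> 'a \<Rightarrow> 'a set" where
  "regular_normal_cone C x =
     {d. \<exists>r \<in> o[at x within C](\<lambda>y. norm (y - x)). \<forall>y\<in>C. d \<bullet> (y - x) \<le> r y}"

definition polar_cone :: "'a::euclidean_space set \<Rightarrow> 'a set" where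
  "polar_cone D = {y. \<forall>d\<in>D. y \<bullet> d \<le> 0}"

text \<open>A fixed choice of one nearest point of \<open>C\<close> for every point of the space.
  For nonempty closed convex \<open>C\<close> the only such map is \<open>closest_point C\<close>.\<close>

definition is_projection :: "'a::euclidean_space set \<Rightarrow> ('a \<Rightarrow> 'a) \<Rightarrow> bool" where
  "is_projection C P \<longleftrightarrow> (\<forall>x. P x \<in> C \<and> (\<forall>y\<in>C. norm (P x - x) \<le> norm (y - x)))"

definition set_liminf :: "(nat \<Rightarrow> 'a::euclidean_space set) \<Rightarrow> 'a set" where
  "set_liminf C = {x. \<exists>xs. (\<forall>k. xs k \<in> C k) \<and> xs \<longlonglongrightarrow> x}"

definition terminates_finitely :: "(nat \<Rightarrow> 'a) \<Rightarrow> 'a set \<Rightarrow> bool" where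
  "terminates_finitely x C \<longleftrightarrow> (\<exists>k0. \<forall>k\<ge>k0. x k \<in> C)"

definition equilibria ::
    "'a::euclidean_space set \<Rightarrow> ('a \<Rightarrow> 'a \<Rightarrow> real) \<Rightarrow> 'a set" where
  "equilibria S \<phi> = {x \<in> S. \<forall>y\<in>S. \<phi> x y \<ge> 0}"

definition stationary_points ::
    "'a::euclidean_space set \<Rightarrow> ('a \<Rightarrow> 'a \<Rightarrow> real) \<Rightarrow> 'a set" where
  "stationary_points S \<phi> =
     {x \<in> S. \<exists>u \<in> diag_subdifferential \<phi> x. \<forall>y\<in>S. u \<bullet> (y - x) \<ge> 0}"

text \<open>The set \<open>P\<^bsub>T\<^sub>S(x)\<^esub>(-\<partial>\<^sub>y\<phi>(x,x))\<close>.\<close>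

definition projected_subgradients ::
    "'a::euclidean_space set \<Rightarrow> ('a \<Rightarrow> 'a \<Rightarrow> real) \<Rightarrow> 'a \<Rightarrow> 'a set" where
  "projected_subgradients S \<phi> x =
     (\<lambda>u. closest_point (tangent_cone S x) (- u)) ` diag_subdifferential \<phi> x"

text \<open>\<open>P\<close> is the chosen projection onto \<open>Sbar\<close>. The upper limit is taken in the
  extended reals along the filter of indices \<open>k \<in> K\<close>, \<open>k \<rightarrow> \<infinity>\<close>. Only the values of
  \<open>H\<close> on \<open>Sbar\<close> and of \<open>u\<close>, \<open>v\<close> on \<open>K\<close> are constrained.\<close>

definition augmented_weakly_sharp ::
    "'a::euclidean_space set \<Rightarrow> ('a \<Rightarrow> 'a \<Rightarrow> real) \<Rightarrow> 'a set \<Rightarrow> ('a \<Rightarrow> 'a) \<Rightarrow> (nat \<Rightarrow> 'a) \<Rightarrow> bool"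
  where
  "augmented_weakly_sharp S \<phi> Sbar P x \<longleftrightarrow>
     (let K = {k. x k \<notin> Sbar} in infinite K \<longrightarrow>
       (\<exists>H :: 'a \<Rightarrow> 'a set.
          (\<exists>\<alpha>>0. \<forall>z\<in>Sbar. (\<lambda>b. \<alpha> *\<^sub>R b) ` cball 0 1
             \<subseteq> H z + polar_cone (tangent_cone S z \<inter> regular_normal_cone Sbar z)) \<and>
          (\<forall>u v. (\<forall>k\<in>K. u k \<in> diag_subdifferential \<phi> (x k)) \<and> (\<forall>k\<in>K. v k \<in> H (P (x k))) \<longrightarrow>
             Limsup (inf sequentially (principal K))
               (\<lambda>k. ereal (1 / norm (x k - P (x k)) * ((u k - v k) \<bullet> (x k - P (x k))))) \<ge> 0)))"

end

theory Submission
  imports Defs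
begin

text \<open>If \<open>\<xi>\<close> is a projection of \<open>-u\<close> onto the tangent cone at \<open>x\<close>, then
  \<open>\<langle>-u, y - x\<rangle> \<le> \<langle>\<xi>, y - x\<rangle>\<close> for all \<open>y \<in> S\<close>. For (ii), let \<open>x\<close> be an iterate outside the set of
  equilibria, \<open>p\<close> its projection and \<open>e = (x - p) / \<parallel>x - p\<parallel>\<close>, which is both tangent to \<open>S\<close> and normal to
  the equilibria at \<open>p\<close>. Taking \<open>y = p\<close> gives \<open>\<langle>u, e\<rangle> \<le> \<parallel>\<xi>\<parallel>\<close>, while condition (a) gives some
  \<open>v \<in> H p\<close> with \<open>\<langle>v, e\<rangle> \<ge> \<alpha>\<close>. Hence \<open>\<langle>u - v, e\<rangle> \<le> \<parallel>\<xi>\<parallel> - \<alpha>\<close>, which contradicts (b) if this happens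
  infinitely often with \<open>\<xi> \<rightarrow> 0\<close>. For (i), a stationary point has a subgradient \<open>u\<close> such that \<open>-u\<close> is
  polar to the tangent cone, so its projection is \<open>0\<close>.\<close>

text \<open>Convexity supplies the inclusion from right to left: a short enough step from
  \<open>x\<close> along \<open>y - x\<close> stays in \<open>S\<close>, so every direction in the
  cone hull, and every limit of such directions, is a limit of difference quotients. Closedness,
  convexity and the cone property are then inherited from the closed conic hull.\<close>

lemma tangent_cone_of_convex:
  fixes S :: "'a::euclidean_space set"
  assumes "convex S" and x: "x \<in> S"
  shows "tangent_cone S x = closure (cone hull ((\<lambda>y. y - x) ` S))"
proof (intro equalityI subsetI)
  fix d assume "d \<in> tangent_cone S x"
  then obtain xs \<tau> where xs: "\<And>j::nat. xs j \<in> S" and \<tau>: "\<And>j. \<tau> j > 0"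
      and lim: "(\<lambda>j. (xs j - x) /\<^sub>R \<tau> j) \<longlonglongrightarrow> d"
    unfolding tangent_cone_def by blast
  have "(xs j - x) /\<^sub>R \<tau> j \<in> cone hull ((\<lambda>y. y - x) ` S)" for j
    using xs[of j] less_imp_le[OF \<tau>[of j]]
    by (auto simp: cone_hull_expl intro!: exI[of _ "inverse (\<tau> j)"] exI[of _ "xs j - x"])
  then show "d \<in> closure (cone hull ((\<lambda>y. y - x) ` S))"
    unfolding closure_sequential using lim by (intro exI[of _ "\<lambda>j. (xs j - x) /\<^sub>R \<tau> j"]) simp
next
  fix d assume "d \<in> closure (cone hull ((\<lambda>y. y - x) ` S))"
  then obtain ds where ds: "\<And>j::nat. ds j \<in> cone hull ((\<lambda>y. y - x) ` S)" and lim: "ds \<longlonglongrightarrow> d"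
    unfolding closure_sequential by blast
  have "\<exists>t y. t \<ge> 0 \<and> y \<in> S \<and> ds j = t *\<^sub>R (y - x)" for j
    using ds[of j] by (auto simp: cone_hull_expl)
  then obtain t y where t: "\<And>j. t j \<ge> 0" and y: "\<And>j. y j \<in> S"
      and eq: "\<And>j. ds j = t j *\<^sub>R (y j - x)"
    by metis
  \<comment> \<open>The factor \<open>real (Suc j)\<close> forces \<tau> to 0. The factor
    \<open>1 + t j\<close> keeps \<open>\<tau> j * t j \<le> 1\<close> even if \<open>t\<close> is
    unbounded, so that the step ends at a convex combination of \<open>x\<close> and
    \<open>y j\<close>.\<close>
  define \<tau> where "\<tau> j = 1 / (real (Suc j) * (1 + t j))" for j
  have pos: "\<tau> j > 0" for j
    using t[of j] by (simp add: \<tau>_def)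
  have le: "\<tau> j \<le> 1 / real (Suc j)" for j
    unfolding \<tau>_def using t[of j] mult_left_mono[of 1 "1 + t j" "real (Suc j)"]
    by (intro divide_left_mono) auto
  have le1: "\<tau> j * t j \<le> 1" for j
  proof -
    have "t j \<le> 1 * (1 + t j)" using t[of j] by simp
    also have "\<dots> \<le> real (Suc j) * (1 + t j)"
      by (rule mult_right_mono) (use t[of j] in auto)
    finally show ?thesis using t[of j] by (simp add: \<tau>_def)
  qed
  have \<tau>0: "\<tau> \<longlonglongrightarrow> 0"
    by (rule tendsto_sandwich[OF _ _ tendsto_const LIMSEQ_Suc[OF lim_1_over_n]])
      (use pos le in \<open>auto simp: less_imp_le\<close>)
  have "x + \<tau> j *\<^sub>R ds j \<in> S" for j
    using convexD_alt[OF assms(1) x y[of j], of "\<tau> j * t j"] le1[of j] pos[of j] t[of j]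
    by (simp add: eq algebra_simps)
  moreover have "(\<lambda>j. x + \<tau> j *\<^sub>R ds j) \<longlonglongrightarrow> x"
    using tendsto_add[OF tendsto_const[of x] tendsto_scaleR[OF \<tau>0 lim]] by simp
  moreover have "(\<lambda>j. (x + \<tau> j *\<^sub>R ds j - x) /\<^sub>R \<tau> j) \<longlonglongrightarrow> d"
    using lim pos by (simp add: less_imp_neq[symmetric])
  ultimately show "d \<in> tangent_cone S x"
    unfolding tangent_cone_def mem_Collect_eq using pos \<tau>0
    by (intro exI[of _ "\<lambda>j. x + \<tau> j *\<^sub>R ds j"] exI[of _ \<tau>]) simp
qed

lemma closed_tangent_cone:
  "convex S \<Longrightarrow> x \<in> S \<Longrightarrow> closed (tangent_cone S x)"
  by (simp add: tangent_cone_of_convex)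

lemma convex_tangent_cone:
  assumes "convex S" "x \<in> S"
  shows "convex (tangent_cone S x)"
proof -
  have "convex ((\<lambda>y. y - x) ` S)"
    using convex_translation[OF assms(1), of "-x"] by simp
  then show ?thesis
    by (simp add: tangent_cone_of_convex assms convex_closure convex_cone_hull)
qed

lemma cone_tangent_cone:
  "convex S \<Longrightarrow> x \<in> S \<Longrightarrow> cone (tangent_cone S x)"
  by (simp add: tangent_cone_of_convex cone_closure cone_cone_hull)

lemma diff_mem_tangent_cone:
  assumes "convex S" "x \<in> S" "y \<in> S"
  shows "y - x \<in> tangent_cone S x"
  unfolding tangent_cone_of_convex[OF assms(1,2)]
  by (intro subsetD[OF closure_subset] hull_inc imageI assms(3))

text \<open>The inequality holds for each difference quotient of points of \<open>S\<close> and
  survives the limit.\<close>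

lemma polar_tangent_cone:
  assumes u: "\<And>y. y \<in> S \<Longrightarrow> u \<bullet> (y - x) \<ge> 0" and d: "d \<in> tangent_cone S x"
  shows "u \<bullet> d \<ge> 0"
proof -
  obtain xs \<tau> where xs: "\<And>j::nat. xs j \<in> S" and \<tau>: "\<And>j. \<tau> j > 0"
      and lim: "(\<lambda>j. (xs j - x) /\<^sub>R \<tau> j) \<longlonglongrightarrow> d"
    using d unfolding tangent_cone_def by blast
  have "(\<lambda>j. u \<bullet> ((xs j - x) /\<^sub>R \<tau> j)) \<longlonglongrightarrow> u \<bullet> d"
    by (intro tendsto_intros lim)
  then show ?thesis
    by (rule LIMSEQ_le_const) (use u xs \<tau> in \<open>auto simp: less_imp_le\<close>)
qed

text \<open>Expanding the squared distance from \<open>a\<close> to \<open>d\<close> shows that 0 is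
  a nearest point and the only one. Uniqueness matters because \<open>closest_point\<close> is a
  choice among the minimizers.\<close>

lemma closest_point_polar:
  fixes T :: "'a::euclidean_space set"
  assumes "0 \<in> T" and "\<And>d. d \<in> T \<Longrightarrow> a \<bullet> d \<le> 0"
  shows "closest_point T a = 0"
  unfolding closest_point_def
proof (rule some_equality)
  have sq: "(dist a d)\<^sup>2 = (norm a)\<^sup>2 - 2 * (a \<bullet> d) + (norm d)\<^sup>2" for d
    by (simp add: dist_norm power2_norm_eq_inner algebra_simps inner_commute)
  show "0 \<in> T \<and> (\<forall>y\<in>T. dist a 0 \<le> dist a y)"
  proof (intro conjI ballI assms(1))
    fix y assume "y \<in> T"
    have "(dist a 0)\<^sup>2 \<le> (dist a y)\<^sup>2"
      using order_trans[OF _ zero_le_power2, of "2 * (a \<bullet> y)" "norm y"] assms(2)[OF \<open>y \<in> T\<close>]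
      unfolding sq by simp
    then show "dist a 0 \<le> dist a y" by (rule power2_le_imp_le) simp
  qed
  fix d assume d: "d \<in> T \<and> (\<forall>y\<in>T. dist a d \<le> dist a y)"
  then have "(dist a d)\<^sup>2 \<le> (dist a 0)\<^sup>2"
    using assms(1) by (intro power_mono) auto
  then have "(norm d)\<^sup>2 \<le> 2 * (a \<bullet> d)"
    unfolding sq by simp
  also have "\<dots> \<le> 0"
    using assms(2)[of d] d by simp
  finally have "(norm d)\<^sup>2 \<le> 0" .
  then show "d = 0" by simp
qed

text \<open>In a convex cone the projection plus \<open>d\<close> is again a point of
  \<open>T\<close>; testing the variational inequality of the projection there leaves exactly
  \<open>d\<close>. This is the part of Moreau's decomposition saying that the residual is polar to
  \<open>T\<close>.\<close>

lemma closest_point_cone_inner_le: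
  fixes T :: "'a::euclidean_space set"
  assumes "closed T" "convex T" "cone T" and d: "d \<in> T"
  shows "a \<bullet> d \<le> closest_point T a \<bullet> d"
proof -
  let ?p = "closest_point T a"
  have "?p \<in> T"
    using closest_point_in_set[OF assms(1)] d by blast
  then have "?p + d \<in> T"
    using assms(2,3) d convex_cone by blast
  then have "(a - ?p) \<bullet> (?p + d - ?p) \<le> 0"
    by (rule closest_point_dot[OF assms(2,1)])
  then show ?thesis by (simp add: inner_diff_left)
qed

text \<open>Squaring the nearest point inequality gives
  \<open>2 * ((x - p) \<bullet> (y - p)) \<le> (norm (y - p))\<^sup>2\<close>, a quadratic error and
  hence o(\<open>norm (y - p)\<close>). It is applied to the set of equilibria, which may be
  nonconvex.\<close>

lemma proximal_normal_mem_regular_normal_cone: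
  fixes C :: "'a::euclidean_space set"
  assumes near: "\<And>y. y \<in> C \<Longrightarrow> norm (p - x) \<le> norm (y - x)" and "c \<ge> 0"
  shows "c *\<^sub>R (x - p) \<in> regular_normal_cone C p"
proof -
  define r where "r y = c / 2 * (norm (y - p))\<^sup>2" for y
  have "((\<lambda>y. r y / norm (y - p)) \<longlongrightarrow> 0) (at p within C)"
  proof -
    have "((\<lambda>y. c / 2 * norm (y - p)) \<longlongrightarrow> c / 2 * norm (p - p)) (at p within C)"
      by (intro tendsto_intros)
    \<comment> \<open>At \<open>y = p\<close> both sides are 0, division by zero being 0.\<close>
    moreover have "r y / norm (y - p) = c / 2 * norm (y - p)" for y
      by (cases "y = p") (simp_all add: r_def power2_eq_square)
    ultimately show ?thesis
      by (simp only:) simp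
  qed
  then have "r \<in> o[at p within C](\<lambda>y. norm (y - p))"
    by (rule smalloI_tendsto) (auto simp: eventually_at intro: exI[of _ 1])
  moreover have "(c *\<^sub>R (x - p)) \<bullet> (y - p) \<le> r y" if "y \<in> C" for y
  proof -
    have "(norm (p - x))\<^sup>2 \<le> (norm (y - x))\<^sup>2"
      by (rule power_mono[OF near[OF that]]) simp
    then have "2 * ((x - p) \<bullet> (y - p)) \<le> (norm (y - p))\<^sup>2"
      by (simp add: power2_norm_eq_inner algebra_simps inner_commute)
    then have "c / 2 * (2 * ((x - p) \<bullet> (y - p))) \<le> r y"
      unfolding r_def using \<open>c \<ge> 0\<close> by (intro mult_left_mono) auto
    then show ?thesis by simp
  qed
  ultimately show ?thesis
    unfolding regular_normal_cone_def by blast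
qed

lemma zero_mem_projected_subgradients:
  assumes "convex S" and x: "x \<in> stationary_points S \<phi>"
  shows "0 \<in> projected_subgradients S \<phi> x"
proof -
  obtain u where "x \<in> S" and u: "u \<in> diag_subdifferential \<phi> x" "\<And>y. y \<in> S \<Longrightarrow> u \<bullet> (y - x) \<ge> 0"
    using x unfolding stationary_points_def by blast
  have "closest_point (tangent_cone S x) (- u) = 0"
  proof (rule closest_point_polar)
    show "0 \<in> tangent_cone S x"
      using diff_mem_tangent_cone[OF assms(1) \<open>x \<in> S\<close> \<open>x \<in> S\<close>] by simp
    show "- u \<bullet> d \<le> 0" if "d \<in> tangent_cone S x" for d
      using polar_tangent_cone[OF u(2) that] by simp
  qed
  with u(1) show ?thesis
    unfolding projected_subgradients_def by (metis imageI)
qed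

theorem theorem5p1:
  fixes S :: "(real ^ 'n) set"
    and \<phi> :: "real ^ 'n \<Rightarrow> real ^ 'n \<Rightarrow> real"
    and P :: "real ^ 'n \<Rightarrow> real ^ 'n"
    and x :: "nat \<Rightarrow> real ^ 'n"
  assumes "closed S" and "convex S"
    and "\<And>z. z \<in> S \<Longrightarrow> \<phi> z z = 0"
    and "equilibria S \<phi> \<noteq> {}" and "closed (equilibria S \<phi>)"
    and "\<And>z. z \<in> S \<Longrightarrow> diag_subdifferential \<phi> z \<noteq> {}"
    and "\<And>k. x k \<in> S"
    and "is_projection (equilibria S \<phi>) P"
    and "augmented_weakly_sharp S \<phi> (equilibria S \<phi>) P x"
  shows "(equilibria S \<phi> \<subseteq> stationary_points S \<phi> \<longrightarrow>
           terminates_finitely x (equilibria S \<phi>) \<longrightarrow>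
           0 \<in> set_liminf (\<lambda>k. projected_subgradients S \<phi> (x k))) \<and>
         (0 \<in> set_liminf (\<lambda>k. projected_subgradients S \<phi> (x k)) \<longrightarrow>
           terminates_finitely x (equilibria S \<phi>))"
proof (intro conjI impI)
  let ?E = "equilibria S \<phi>" and ?G = "\<lambda>k. projected_subgradients S \<phi> (x k)"
  assume sub: "?E \<subseteq> stationary_points S \<phi>" and "terminates_finitely x ?E"
  then obtain k0 where k0: "\<And>k. k \<ge> k0 \<Longrightarrow> x k \<in> ?E"
    unfolding terminates_finitely_def by blast
  have zero: "0 \<in> ?G k" if "k \<ge> k0" for k
    using zero_mem_projected_subgradients[OF assms(2)] k0[OF that] sub by blast
  have ne: "?G k \<noteq> {}" for k
    using assms(6)[OF assms(7)] by (simp add: projected_subgradients_def)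
  \<comment> \<open>The lower limit asks for a selection from every set, so the indices before
    \<open>k0\<close> get an arbitrary element.\<close>
  define xi where "xi k = (if k \<ge> k0 then 0 else SOME v. v \<in> ?G k)" for k
  have "xi k \<in> ?G k" for k
    using zero[of k] ne[of k] by (auto simp: xi_def some_in_eq)
  moreover have "xi \<longlonglongrightarrow> 0"
    by (rule tendsto_eventually) (auto simp: xi_def eventually_sequentially)
  ultimately show "0 \<in> set_liminf ?G"
    unfolding set_liminf_def by blast
next
  let ?E = "equilibria S \<phi>" and ?G = "\<lambda>k. projected_subgradients S \<phi> (x k)"
  assume "0 \<in> set_liminf ?G"
  then obtain xi where xi: "\<And>k. xi k \<in> ?G k" "xi \<longlonglongrightarrow> 0"
    unfolding set_liminf_def by blast
  have "\<exists>u. u \<in> diag_subdifferential \<phi> (x k) \<and> xi k = closest_point (tangent_cone S (x k)) (- u)" for k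
    using xi(1)[of k] unfolding projected_subgradients_def by blast
  then obtain u where u: "\<And>k. u k \<in> diag_subdifferential \<phi> (x k)"
      and xi_eq: "\<And>k. xi k = closest_point (tangent_cone S (x k)) (- u k)"
    by metis
  define K where "K = {k. x k \<notin> ?E}"
  have "finite K"
  proof (rule ccontr)
    assume "infinite K"
    then obtain H \<alpha> where "\<alpha> > 0"
      and H: "\<And>z. z \<in> ?E \<Longrightarrow> (\<lambda>b. \<alpha> *\<^sub>R b) ` cball 0 1
             \<subseteq> H z + polar_cone (tangent_cone S z \<inter> regular_normal_cone ?E z)"
      and lims: "\<And>u v. (\<forall>k\<in>K. u k \<in> diag_subdifferential \<phi> (x k)) \<and> (\<forall>k\<in>K. v k \<in> H (P (x k))) \<Longrightarrow>
             Limsup (inf sequentially (principal K))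
               (\<lambda>k. ereal (1 / norm (x k - P (x k)) * ((u k - v k) \<bullet> (x k - P (x k))))) \<ge> 0"
      using assms(9) unfolding augmented_weakly_sharp_def Let_def K_def by blast
    \<comment> \<open>If \<open>x k = P (x k)\<close>, then \<open>e k = 0\<close>; the bound
      \<open>norm (e k) \<le> 1\<close> therefore holds for all \<open>k\<close>, while norm 1 is
      available only on \<open>K\<close>.\<close>
    define e where "e k = (x k - P (x k)) /\<^sub>R norm (x k - P (x k))" for k
    have PE: "P (x k) \<in> ?E" and near: "\<And>y. y \<in> ?E \<Longrightarrow> norm (P (x k) - x k) \<le> norm (y - x k)" for k
      using assms(8) unfolding is_projection_def by auto
    have PS: "P (x k) \<in> S" for k
      using PE[of k] by (simp add: equilibria_def)
    have e_norm: "norm (e k) \<le> 1" for k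
      by (cases "x k = P (x k)") (simp_all add: e_def)
    have e_mem: "e k \<in> tangent_cone S (P (x k)) \<inter> regular_normal_cone ?E (P (x k))" for k
      unfolding e_def
      using mem_cone[OF cone_tangent_cone diff_mem_tangent_cone, OF assms(2) PS assms(2) PS assms(7)]
        proximal_normal_mem_regular_normal_cone[OF near]
      by simp
    have "\<exists>v \<in> H (P (x k)). v \<bullet> e k \<ge> \<alpha>" if "k \<in> K" for k
    proof -
      have "x k \<noteq> P (x k)"
        using that PE[of k] by (auto simp: K_def)
      then have "e k \<bullet> e k = 1"
        by (simp add: e_def flip: power2_norm_eq_inner)
      \<comment> \<open>Condition (a) splits \<open>\<alpha> *\<^sub>R e k\<close> into
        \<open>v + w\<close>. Since \<open>w\<close> is polar to \<open>e k\<close>, all of the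
        inner product \<alpha> must come from \<open>v\<close>.\<close>
      have "\<alpha> *\<^sub>R e k \<in> H (P (x k))
          + polar_cone (tangent_cone S (P (x k)) \<inter> regular_normal_cone ?E (P (x k)))"
        by (rule subsetD[OF H[OF PE] imageI]) (use e_norm[of k] in simp)
      then obtain v w where v: "v \<in> H (P (x k))" and vw: "\<alpha> *\<^sub>R e k = v + w"
        and w: "w \<in> polar_cone (tangent_cone S (P (x k)) \<inter> regular_normal_cone ?E (P (x k)))"
        by (rule set_plus_elim)
      have "w \<bullet> e k \<le> 0"
        using w e_mem[of k] unfolding polar_cone_def by blast
      moreover have "v \<bullet> e k + w \<bullet> e k = \<alpha>"
        using arg_cong[OF vw, of "\<lambda>z. z \<bullet> e k"] \<open>e k \<bullet> e k = 1\<close> by (simp add: inner_add_left)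
      ultimately show ?thesis
        using v by (intro bexI[of _ v]) auto
    qed
    then obtain v where v: "\<And>k. k \<in> K \<Longrightarrow> v k \<in> H (P (x k))" "\<And>k. k \<in> K \<Longrightarrow> v k \<bullet> e k \<ge> \<alpha>"
      by metis
    have u_e: "u k \<bullet> e k \<le> norm (xi k)" for k
    proof -
      \<comment> \<open>The direction \<open>- e k\<close> points from \<open>x k\<close> towards
        \<open>P (x k)\<close>, a point of \<open>S\<close>, so the cone inequality can be tested on
        it.\<close>
      have T: "- e k \<in> tangent_cone S (x k)"
        using mem_cone[OF cone_tangent_cone diff_mem_tangent_cone,
            OF assms(2) assms(7) assms(2) assms(7) PS, of "inverse (norm (x k - P (x k)))"]
        by (simp add: e_def algebra_simps)
      have "- u k \<bullet> - e k \<le> xi k \<bullet> - e k"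
        unfolding xi_eq using assms(2,7) T
        by (intro closest_point_cone_inner_le closed_tangent_cone convex_tangent_cone cone_tangent_cone)
      also have "\<dots> \<le> norm (xi k) * norm (- e k)"
        by (rule norm_cauchy_schwarz)
      also have "\<dots> \<le> norm (xi k)"
        using mult_left_mono[OF e_norm[of k], of "norm (xi k)"] by simp
      finally show ?thesis by simp
    qed
    have "(\<lambda>k. norm (xi k)) \<longlonglongrightarrow> 0"
      using xi(2) by (rule tendsto_norm_zero)
    \<comment> \<open>Half of \<alpha> leaves the uniform gap
      \<open>\<alpha> / 2 - \<alpha> = - \<alpha> / 2\<close>, which keeps the upper limit strictly
      negative. The filter is then restricted to \<open>K\<close>, where \<open>v\<close> is
      controlled.\<close>
    then have "\<forall>\<^sub>F k in sequentially. norm (xi k) < \<alpha> / 2"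
      by (rule order_tendstoD) (use \<open>\<alpha> > 0\<close> in simp)
    then have "\<forall>\<^sub>F k in inf sequentially (principal K).
        ereal (1 / norm (x k - P (x k)) * ((u k - v k) \<bullet> (x k - P (x k)))) \<le> ereal (- \<alpha> / 2)"
      unfolding eventually_inf_principal
    proof (eventually_elim, intro impI)
      fix k assume k: "norm (xi k) < \<alpha> / 2" "k \<in> K"
      have "1 / norm (x k - P (x k)) * ((u k - v k) \<bullet> (x k - P (x k))) = u k \<bullet> e k - v k \<bullet> e k"
        by (simp add: e_def inner_diff_left divide_inverse algebra_simps)
      also have "\<dots> \<le> - \<alpha> / 2"
        using u_e[of k] v(2)[OF k(2)] k(1) by simp
      finally show "ereal (1 / norm (x k - P (x k)) * ((u k - v k) \<bullet> (x k - P (x k)))) \<le> ereal (- \<alpha> / 2)"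
        by simp
    qed
    then have "Limsup (inf sequentially (principal K))
        (\<lambda>k. ereal (1 / norm (x k - P (x k)) * ((u k - v k) \<bullet> (x k - P (x k))))) \<le> ereal (- \<alpha> / 2)"
      by (rule Limsup_bounded)
    with lims[of u v] u v(1) have "0 \<le> ereal (- \<alpha> / 2)"
      by (meson order_trans)
    with \<open>\<alpha> > 0\<close> show False by simp
  qed
  then obtain k0 where "\<And>k. k \<in> K \<Longrightarrow> k < k0"
    unfolding finite_nat_set_iff_bounded by blast
  then show "terminates_finitely x ?E"
    unfolding terminates_finitely_def K_def by (meson linorder_not_less mem_Collect_eq)
qed

end
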